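(* Let $\bm{a}_1,\ldots,\bm{a}_m\in\mathbb{R}^n$ be such that $\{\bm{a}_i-\bm{a}_1\}_{i=2}^m$ spans $\mathbb{R}^n$, let $\bm{x}^\star\in\mathbb{R}^n$, let $c_0>0$ and $\sigma\ge0$, and let $\bm{w}=(w_1,\ldots,w_m)$ be a realization of measurement noise with noise level $\sigma$ (as described in the context, in particular $|w_i|\le\frac12\|\bm{x}^\star-\bm{a}_i\|$ for all $i$) satisfying $\|\bm{w}\|\le c_0\sqrt{m}\,\sigma$. Let $r_i=\|\bm{x}^\star-\bm{a}_i\|+w_i$, let $f(\bm{x})=\sum_{i=1}^m(\|\bm{x}-\bm{a}_i\|-r_i)^2$, and let $\hat{\bm{x}}$ be any global minimizer of $f$ over $\mathbb{R}^n$. Let $K_1,K_2>0$ be the estimation error constants described in the context. Suppose that for some given $\delta>0$, $$\|\bm{x}^\star-\bm{a}_i\|>K_1\sqrt{m}\,\sigma+K_2m\sigma^2+\delta,\qquad i=1,\ldots,m,$$ and $$\kappa:=\frac{\delta}{10m}\,\Lambda-(K_1\sqrt{m}\,\sigma+K_2m\sigma^2)-\frac{4c_0\sigma}{5}>0,$$ where $$\Lambda:=\lambda_{\min}\left(\sum_{i=1}^m\left(\frac{\bm{x}^\star-\bm{a}_i}{\|\bm{x}^\star-\bm{a}_i\|}\right)\left(\frac{\bm{x}^\star-\bm{a}_i}{\|\bm{x}^\star-\bm{a}_i\|}\right)^T\right).$$ Then $\nabla^2 f(\hat{\bm{x}}+\bm{\epsilon})\succ\bm{0}$ for all $\bm{\epsilon}\in\mathbb{R}^n$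 satisfying $\|\bm{\epsilon}\|\le\kappa$; i.e., $f$ is strongly convex over $B(\hat{\bm{x}},\kappa)$.
   Context: $\|\cdot\|$ is the Euclidean norm, $\lambda_{\min}$ is the smallest eigenvalue of a symmetric matrix, $\succ\bm{0}$ means positive definite, and $B(\bar{\bm{x}},r)=\{\bm{x}\in\mathbb{R}^n:\|\bm{x}-\bar{\bm{x}}\|\le r\}$. Noise model: $w_1,\ldots,w_m$ are independent real random variables with mean zero and variance at most $\sigma^2$, and each $|w_i|$ is small compared with $\|\bm{x}^\star-\bm{a}_i\|$, which is made precise here as $|w_i|\le\frac12\|\bm{x}^\star-\bm{a}_i\|$. The statement is about a fixed realization of $\bm{w}$ for which the stated bounds hold. Estimation error constants: $K_1,K_2>0$ are constants determined by $\bm{a}_1,\ldots,\bm{a}_m$, $\bm{x}^\star$ (and the fixed constant $c_0$) with the property that, for every noise level $s\ge0$ and every $\bm{u}\in\mathbb{R}^m$ with $\|\bm{u}\|\le c_0\sqrt{m}\,s$ and $|u_i|\le\frac12\|\bm{x}^\star-\bm{a}_i\|$ for all $i$, every global minimizer $\bm{z}$ of $\bm{x}\mapsto\sum_{i=1}^m(\|\bm{x}-\bm{a}_i\|-\|\bm{x}^\star-\bm{a}_i\|-u_i)^2$ satisfies $\|\bm{z}-\bm{x}^\star\|\le K_1\sqrt{m}\,s+K_2ms^2$. (Such constants exist; this may be taken as given.) *)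

theory Defs
  imports "HOL-Probability.Probability"
begin

(* An m-tuple of reals is a function nat => real read on {1..m} only; its
   Euclidean norm is L2_set u {1..m}. *)

definition least_squares_loss ::
  "nat \<Rightarrow> (nat \<Rightarrow> real ^ 'n) \<Rightarrow> (nat \<Rightarrow> real) \<Rightarrow> real ^ 'n \<Rightarrow> real" where
  "least_squares_loss m a r x = (\<Sum>i = 1..m. (norm (x - a i) - r i)\<^sup>2)"

definition noise_model ::
  "'p measure \<Rightarrow> (nat \<Rightarrow> 'p \<Rightarrow> real) \<Rightarrow> nat \<Rightarrow> real \<Rightarrow> bool" where
  "noise_model M W m \<sigma> \<longleftrightarrow>
     prob_space M \<and>
     prob_space.indep_vars M (\<lambda>_. borel) W {1..m} \<and>
     (\<forall>i\<in>{1..m}. integrable M (W i) \<and> integrable M (\<lambda>\<omega>. (W i \<omega>)\<^sup>2) \<and>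
        prob_space.expectation M (W i) = 0 \<and> prob_space.variance M (W i) \<le> \<sigma>\<^sup>2)"

(* The noise level s and the perturbation u are quantified here, so K1 and K2 are
   tied to the anchors, the true location and c0 only. *)
definition estimation_error_constants ::
  "nat \<Rightarrow> (nat \<Rightarrow> real ^ 'n) \<Rightarrow> real ^ 'n \<Rightarrow> real \<Rightarrow> real \<Rightarrow> real \<Rightarrow> bool" where
  "estimation_error_constants m a xstar c0 K1 K2 \<longleftrightarrow>
     K1 > 0 \<and> K2 > 0 \<and>
     (\<forall>s u. s \<ge> 0 \<longrightarrow> L2_set u {1..m} \<le> c0 * sqrt (real m) * s \<longrightarrow>
        (\<forall>i\<in>{1..m}. \<bar>u i\<bar> \<le> 1 / 2 * norm (xstar - a i)) \<longrightarrow>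
        (\<forall>z. is_arg_min (least_squares_loss m a (\<lambda>i. norm (xstar - a i) + u i)) (\<lambda>_. True) z \<longrightarrow>
           norm (z - xstar) \<le> K1 * sqrt (real m) * s + K2 * real m * s\<^sup>2))"

definition symmetric_matrix :: "real ^ 'n ^ 'n \<Rightarrow> bool" where
  "symmetric_matrix A \<longleftrightarrow> transpose A = A"

definition positive_definite :: "real ^ 'n ^ 'n \<Rightarrow> bool" where
  "positive_definite A \<longleftrightarrow> symmetric_matrix A \<and> (\<forall>v. v \<noteq> 0 \<longrightarrow> v \<bullet> (A *v v) > 0)"

definition eigenvalue :: "real ^ 'n ^ 'n \<Rightarrow> real \<Rightarrow> bool" where
  "eigenvalue A l \<longleftrightarrow> (\<exists>v. v \<noteq> 0 \<and> A *v v = l *\<^sub>R v)"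

(* Meaningful for symmetric A, whose real eigenvalues form a finite nonempty set. *)
definition lambda_min :: "real ^ 'n ^ 'n \<Rightarrow> real" where
  "lambda_min A = (LEAST l. eigenvalue A l)"

definition outer_product :: "real ^ 'n \<Rightarrow> real ^ 'n \<Rightarrow> real ^ 'n ^ 'n" where
  "outer_product u v = (\<chi> i j. u $ i * v $ j)"

(* A relation rather than a function: it asserts that f is differentiable near x
   and that its gradient is differentiable at x.  H is then unique. *)
definition has_hessian :: "(real ^ 'n \<Rightarrow> real) \<Rightarrow> real ^ 'n ^ 'n \<Rightarrow> real ^ 'n \<Rightarrow> bool" where
  "has_hessian f H x \<longleftrightarrow>
     (\<exists>g. (\<forall>\<^sub>F y in nhds x. GDERIV f y :> g y) \<and> (g has_derivative (\<lambda>h. H *v h)) (at x))"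

definition strongly_convex_on :: "'a::real_normed_vector set \<Rightarrow> ('a \<Rightarrow> real) \<Rightarrow> bool" where
  "strongly_convex_on S f \<longleftrightarrow>
     convex S \<and>
     (\<exists>\<mu>>0. \<forall>x\<in>S. \<forall>y\<in>S. \<forall>t\<in>{0..1}.
        f ((1 - t) *\<^sub>R x + t *\<^sub>R y)
          \<le> (1 - t) * f x + t * f y - \<mu> / 2 * t * (1 - t) * (norm (x - y))\<^sup>2)"

end

theory Submission
  imports Defs
begin

text \<open>
  Write \<open>d i = x - a i\<close>. In direction \<open>v\<close> the Hessian of the loss at \<open>x\<close> has the quadratic form
  \<open>2 * (\<Sum>i. (1 - r i / norm (d i)) * (norm v)\<^sup>2 + r i / norm (d i) * (sgn (d i) \<bullet> v)\<^sup>2)\<close>.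
  At the true location and without noise, the isotropic part vanishes and the radial part is
  \<open>2 * (\<Sum>i. (sgn (xstar - a i) \<bullet> v)\<^sup>2)\<close>, which is at least \<open>2 * \<Lambda> * (norm v)\<^sup>2\<close> by the variational
  description of the least eigenvalue (\<open>lambda_min_rayleigh\<close>). The claim is that this survives
  perturbation by the noise and by moving from the true location to a point \<open>x\<close> of the ball.

  The definition of \<open>\<kappa>\<close> is made for this. The minimizer lies within the estimation error
  \<open>K1 * sqrt m * \<sigma> + K2 * m * \<sigma>\<^sup>2\<close> of the true location, so every \<open>x\<close> in the ball satisfies
  \<open>norm (x - xstar) \<le> \<delta> * \<Lambda> / (10 * m) - 4 / 5 * c0 * \<sigma>\<close>. The total noise is at most \<open>m * c0 * \<sigma>\<close>
  by the Cauchy-Schwarz inequality. Hence \<open>m * norm (x - xstar)\<close> plus four fifths of the total noise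
  is at most \<open>\<delta> * \<Lambda> / 10\<close>, while all true ranges are at least \<open>\<delta>\<close>. Moreover \<open>\<Lambda> \<le> m\<close>, so \<open>x\<close> is
  within \<open>\<delta> / 10\<close> of the true location; it avoids all anchors and ranges change by a tenth at most.

  With these bounds, \<open>range_curvature_lower_bound\<close> estimates the contribution of a single anchor, and
  \<open>least_squares_hessian_lower_bound\<close> adds the estimates up to
  \<open>v \<bullet> H v \<ge> 3 / 10 * \<Lambda> * (norm v)\<^sup>2\<close>. The constant does not depend on \<open>x\<close>, so the bound gives both
  positive definiteness and, by \<open>strongly_convex_on_hessian\<close>, strong convexity on the ball.
\<close>

section \<open>Symmetric matrices and the least eigenvalue\<close>

lemma outer_product_mult_vec: "outer_product u v *v x = (v \<bullet> x) *\<^sub>R u"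
  by (simp add: outer_product_def matrix_vector_mult_def vec_eq_iff inner_vec_def
      sum_distrib_left sum_distrib_right mult_ac)

lemma sum_matrix_mult_vec: "(\<Sum>i\<in>I. A i) *v x = (\<Sum>i\<in>I. A i *v x)"
  for A :: "'i \<Rightarrow> real ^ 'n ^ 'm"
  by (induction I rule: infinite_finite_induct) (simp_all add: matrix_vector_mult_add_rdistrib)

lemma transpose_sum: "transpose (\<Sum>i\<in>I. A i) = (\<Sum>i\<in>I. transpose (A i))"
  for A :: "'i \<Rightarrow> real ^ 'n ^ 'm"
  by (simp add: transpose_def vec_eq_iff)

lemma symmetric_outer_product: "symmetric_matrix (outer_product u u)"
  by (simp add: symmetric_matrix_def outer_product_def transpose_def vec_eq_iff mult.commute)

lemma symmetric_sum: "(\<And>i. i \<in> I \<Longrightarrow> symmetric_matrix (A i)) \<Longrightarrow> symmetric_matrix (\<Sum>i\<in>I. A i)"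
  by (simp add: symmetric_matrix_def transpose_sum)

lemma symmetric_inner: "symmetric_matrix A \<Longrightarrow> u \<bullet> (A *v v) = (A *v u) \<bullet> v"
  by (metis dot_lmul_matrix symmetric_matrix_def transpose_matrix_vector)

text \<open>
  For small \<open>t\<close> of sign opposite to \<open>b\<close> the linear term would win. This is the first-order
  condition at a minimum, stated for quadratics so that no differentiation is needed.
\<close>

lemma nonneg_quadratic_linear_part_zero:
  fixes b c :: real
  assumes nonneg: "\<And>t. 0 \<le> t * b + t\<^sup>2 * c"
  shows "b = 0"
proof (rule ccontr)
  assume "b \<noteq> 0"
  define t where "t = - b / (1 + \<bar>c\<bar>)"
  have pos: "1 + \<bar>c\<bar> > 0" by simp
  have "t * b + t\<^sup>2 * c = (b\<^sup>2 / (1 + \<bar>c\<bar>)\<^sup>2) * (c - (1 + \<bar>c\<bar>))"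
    using pos unfolding t_def power2_eq_square by (simp add: divide_simps) (simp add: algebra_simps)
  moreover have "c - (1 + \<bar>c\<bar>) < 0" by simp
  moreover have "b\<^sup>2 / (1 + \<bar>c\<bar>)\<^sup>2 > 0" using \<open>b \<noteq> 0\<close> pos by simp
  ultimately show False using nonneg[of t] mult_pos_neg by (metis not_le)
qed

text \<open>
  The Rayleigh quotient attains its minimum on the unit sphere by compactness. Moving from a
  minimizer in the direction \<open>g\<close> of its own residual \<open>A v0 - l v0\<close> forces \<open>g \<bullet> g = 0\<close>, so the minimizer
  is an eigenvector; as every eigenvalue is itself a Rayleigh quotient, the minimum is the least
  eigenvalue, and in particular the \<open>LEAST\<close> in \<^const>\<open>lambda_min\<close> is attained.
\<close>

lemma lambda_min_rayleigh:
  fixes A :: "real ^ 'n ^ 'n"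
  assumes sym: "symmetric_matrix A"
  shows "lambda_min A * (norm v)\<^sup>2 \<le> v \<bullet> (A *v v)"
proof -
  let ?q = "\<lambda>v. v \<bullet> (A *v v)"
  have "continuous_on (sphere 0 1) ?q"
    by (intro continuous_intros matrix_vector_mult_linear_continuous_on)
  moreover have "compact (sphere (0 :: real ^ 'n) 1)" "sphere (0 :: real ^ 'n) 1 \<noteq> {}"
    by simp_all
  ultimately obtain v0 where v0: "norm v0 = 1" and min: "\<And>v. norm v = 1 \<Longrightarrow> ?q v0 \<le> ?q v"
    using continuous_attains_inf[of "sphere 0 1" ?q] by auto
  define l where "l = ?q v0"
  have rayleigh: "l * (norm v)\<^sup>2 \<le> ?q v" for v
  proof (cases "v = 0")
    case False
    then have "l \<le> ?q (v /\<^sub>R norm v)" unfolding l_def by (intro min) simp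
    also have "\<dots> = ?q v / (norm v)\<^sup>2"
      using False by (simp add: matrix_vector_mult_scaleR divide_simps power2_eq_square)
    finally show ?thesis using False by (simp add: divide_simps)
  qed simp
  have "A *v v0 - l *\<^sub>R v0 = 0"
  proof -
    have expand: "0 \<le> t * (2 * (g \<bullet> (A *v v0) - l * (g \<bullet> v0))) + t\<^sup>2 * (?q g - l * (g \<bullet> g))" for g t
    proof -
      have "?q (v0 + t *\<^sub>R g) = l + 2 * t * (g \<bullet> (A *v v0)) + t\<^sup>2 * ?q g"
        using symmetric_inner[OF sym, of v0 g]
        by (simp add: l_def inner_add_left inner_add_right power2_eq_square inner_commute algebra_simps)
      moreover have "(norm (v0 + t *\<^sub>R g))\<^sup>2 = 1 + 2 * t * (g \<bullet> v0) + t\<^sup>2 * (g \<bullet> g)"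
        using v0 unfolding power2_norm_eq_inner norm_eq_1
        by (simp add: inner_add_left inner_add_right power2_eq_square inner_commute)
      ultimately show ?thesis using rayleigh[of "v0 + t *\<^sub>R g"] by (simp add: algebra_simps)
    qed
    let ?g = "A *v v0 - l *\<^sub>R v0"
    have "?g \<bullet> (A *v v0) - l * (?g \<bullet> v0) = 0"
      using nonneg_quadratic_linear_part_zero[OF expand[of _ ?g]] by simp
    then have "?g \<bullet> ?g = 0" by (simp only: inner_diff_right inner_scaleR_right)
    then show ?thesis by simp
  qed
  then have "eigenvalue A l"
    unfolding eigenvalue_def using v0 by (intro exI[of _ v0]) auto
  moreover have "l \<le> l'" if ev: "eigenvalue A l'" for l'
  proof -
    obtain v where v: "v \<noteq> 0" "A *v v = l' *\<^sub>R v" using ev unfolding eigenvalue_def by blast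
    then have "l * (norm v)\<^sup>2 \<le> l' * (norm v)\<^sup>2"
      using rayleigh[of v] by (simp add: power2_norm_eq_inner)
    then show ?thesis using v by simp
  qed
  ultimately have "lambda_min A = l" unfolding lambda_min_def by (intro Least_equality)
  then show ?thesis using rayleigh by simp
qed

section \<open>Gradient and Hessian of the least-squares loss\<close>

definition least_squares_gradient ::
  "nat \<Rightarrow> (nat \<Rightarrow> real ^ 'n) \<Rightarrow> (nat \<Rightarrow> real) \<Rightarrow> real ^ 'n \<Rightarrow> real ^ 'n" where
  "least_squares_gradient m a r x =
     (\<Sum>i = 1..m. 2 *\<^sub>R ((x - a i) - r i *\<^sub>R sgn (x - a i)))"

definition least_squares_hessian ::
  "nat \<Rightarrow> (nat \<Rightarrow> real ^ 'n) \<Rightarrow> (nat \<Rightarrow> real) \<Rightarrow> real ^ 'n \<Rightarrow> real ^ 'n ^ 'n" where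
  "least_squares_hessian m a r x =
     (\<Sum>i = 1..m. (2 * (1 - r i / norm (x - a i))) *\<^sub>R mat 1
        + (2 * (r i / norm (x - a i))) *\<^sub>R outer_product (sgn (x - a i)) (sgn (x - a i)))"

lemma least_squares_hessian_mult_vec:
  "least_squares_hessian m a r x *v h =
     (\<Sum>i = 1..m. (2 * (1 - r i / norm (x - a i))) *\<^sub>R h
        + (2 * (r i / norm (x - a i)) * (sgn (x - a i) \<bullet> h)) *\<^sub>R sgn (x - a i))"
  by (simp add: least_squares_hessian_def sum_matrix_mult_vec matrix_vector_mult_add_rdistrib
      outer_product_mult_vec flip: scaleR_matrix_vector_assoc)

lemma symmetric_least_squares_hessian: "symmetric_matrix (least_squares_hessian m a r x)"
  unfolding least_squares_hessian_def
  by (intro symmetric_sum)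
    (simp add: symmetric_matrix_def outer_product_def transpose_def mat_def vec_eq_iff mult.commute)

lemma quadratic_form_least_squares_hessian:
  "v \<bullet> (least_squares_hessian m a r x *v v) =
     2 * (\<Sum>i = 1..m. (1 - r i / norm (x - a i)) * (norm v)\<^sup>2
        + (r i / norm (x - a i)) * (sgn (x - a i) \<bullet> v)\<^sup>2)"
  unfolding least_squares_hessian_mult_vec power2_norm_eq_inner
  by (simp add: inner_sum_right inner_add_right sum_distrib_left power2_eq_square
      inner_commute algebra_simps)

text \<open>
  Moving radially does not change the direction, and a tangential motion turns it at rate
  \<open>1 / norm d\<close>: the derivative is the projection onto the orthogonal complement of \<open>d\<close>, divided
  by \<open>norm d\<close>.
\<close>

lemma has_derivative_sgn:
  fixes d :: "'a :: real_inner"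
  assumes "d \<noteq> 0"
  shows "(sgn has_derivative (\<lambda>h. (h - (sgn d \<bullet> h) *\<^sub>R sgn d) /\<^sub>R norm d)) (at d)"
proof -
  have "((\<lambda>y. inverse (norm y)) has_derivative
      (\<lambda>h. - (inverse (norm d) * (h \<bullet> sgn d) * inverse (norm d)))) (at d)"
    using assms by (intro Deriv.has_derivative_inverse has_derivative_norm) auto
  then have "((\<lambda>y. inverse (norm y) *\<^sub>R y) has_derivative
      (\<lambda>h. inverse (norm d) *\<^sub>R h
        + (- (inverse (norm d) * (h \<bullet> sgn d) * inverse (norm d))) *\<^sub>R d)) (at d)"
    by (rule has_derivative_scaleR[OF _ has_derivative_ident])
  moreover have "(\<lambda>y :: 'a. inverse (norm y) *\<^sub>R y) = sgn"
    by (simp add: sgn_div_norm fun_eq_iff)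
  ultimately show ?thesis
    by (simp add: sgn_div_norm inner_commute scaleR_diff_right mult_ac)
qed

lemma has_derivative_shift: "((\<lambda>x. x - c) has_derivative (\<lambda>h. h)) (at x)"
  for c x :: "'a :: real_normed_vector"
  using has_derivative_diff[OF has_derivative_ident has_derivative_const, of c "at x"] by simp

lemma GDERIV_least_squares_loss:
  assumes "\<And>i. i \<in> {1..m} \<Longrightarrow> x \<noteq> a i"
  shows "GDERIV (least_squares_loss m a r) x :> least_squares_gradient m a r x"
proof -
  have "((\<lambda>x. (norm (x - a i) - r i)\<^sup>2) has_derivative
          (\<lambda>h. h \<bullet> (2 *\<^sub>R ((x - a i) - r i *\<^sub>R sgn (x - a i))))) (at x)"
    if i: "i \<in> {1..m}" for i
  proof -
    have "x - a i = norm (x - a i) *\<^sub>R sgn (x - a i)" using assms[OF i] by (simp add: sgn_div_norm)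
    then have eq: "norm (x - a i) * (h \<bullet> sgn (x - a i)) = h \<bullet> x - h \<bullet> a i" for h
      by (metis inner_scaleR_right inner_diff_right)
    have "((\<lambda>x. norm (x - a i)) has_derivative (\<lambda>h. h \<bullet> sgn (x - a i))) (at x)"
      by (rule has_derivative_compose[OF has_derivative_shift has_derivative_norm])
        (use assms[OF i] in simp)
    then have "((\<lambda>x. norm (x - a i) - r i) has_derivative (\<lambda>h. h \<bullet> sgn (x - a i))) (at x)"
      using has_derivative_diff[OF _ has_derivative_const] by fastforce
    from has_derivative_power[OF this, of 2] show ?thesis
      by (rule has_derivative_eq_rhs) (simp add: fun_eq_iff inner_diff_right eq algebra_simps)
  qed
  then show ?thesis
    unfolding gderiv_def least_squares_loss_def[abs_def] least_squares_gradient_def inner_sum_right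
    by (intro has_derivative_sum)
qed

lemma has_derivative_least_squares_gradient:
  assumes "\<And>i. i \<in> {1..m} \<Longrightarrow> x \<noteq> a i"
  shows "(least_squares_gradient m a r has_derivative (\<lambda>h. least_squares_hessian m a r x *v h)) (at x)"
proof -
  have "((\<lambda>x. 2 *\<^sub>R ((x - a i) - r i *\<^sub>R sgn (x - a i))) has_derivative
      (\<lambda>h. (2 * (1 - r i / norm (x - a i))) *\<^sub>R h
        + (2 * (r i / norm (x - a i)) * (sgn (x - a i) \<bullet> h)) *\<^sub>R sgn (x - a i))) (at x)"
    if i: "i \<in> {1..m}" for i
  proof -
    have "((\<lambda>x. sgn (x - a i)) has_derivative
        (\<lambda>h. (h - (sgn (x - a i) \<bullet> h) *\<^sub>R sgn (x - a i)) /\<^sub>R norm (x - a i))) (at x)"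
      by (rule has_derivative_compose[OF has_derivative_shift has_derivative_sgn])
        (use assms[OF i] in simp)
    then have "((\<lambda>x. 2 *\<^sub>R ((x - a i) - r i *\<^sub>R sgn (x - a i))) has_derivative
        (\<lambda>h. 2 *\<^sub>R ((h - 0)
          - r i *\<^sub>R ((h - (sgn (x - a i) \<bullet> h) *\<^sub>R sgn (x - a i)) /\<^sub>R norm (x - a i))))) (at x)"
      by (intro has_derivative_scaleR_right has_derivative_diff has_derivative_ident has_derivative_const)
    then show ?thesis
      by (rule has_derivative_eq_rhs) (simp add: fun_eq_iff divide_inverse algebra_simps)
  qed
  then show ?thesis
    unfolding least_squares_gradient_def[abs_def] least_squares_hessian_mult_vec
    by (intro has_derivative_sum)
qed

text \<open>
  The loss fails to be smooth only at the anchors. They form a closed set, so the gradient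
  formula holds in a whole neighbourhood of any other point.
\<close>

lemma has_hessian_least_squares_loss:
  assumes off: "\<And>i. i \<in> {1..m} \<Longrightarrow> x \<noteq> a i"
  shows "has_hessian (least_squares_loss m a r) (least_squares_hessian m a r x) x"
proof -
  have "open (- a ` {1..m})" by (intro open_Compl finite_imp_closed) simp
  then have "\<forall>\<^sub>F y in nhds x. y \<in> - a ` {1..m}"
    using off by (intro eventually_nhds_in_open) blast+
  then have "\<forall>\<^sub>F y in nhds x. GDERIV (least_squares_loss m a r) y :> least_squares_gradient m a r y"
    by eventually_elim (auto intro!: GDERIV_least_squares_loss)
  then show ?thesis
    unfolding has_hessian_def using has_derivative_least_squares_gradient[of m x a r] off by blast
qed

section \<open>Strong convexity from a uniform lower bound on the Hessian\<close>

text \<open>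
  Along a segment from \<open>x\<close> to \<open>y\<close> the second derivative of \<open>f\<close> is at least
  \<open>\<mu> * (norm (y - x))\<^sup>2\<close>, so subtracting the quadratic with exactly this second derivative leaves a
  convex function on the unit interval; convexity of the difference is strong convexity of \<open>f\<close>.
\<close>

lemma strongly_convex_on_hessian:
  fixes f :: "real ^ 'n \<Rightarrow> real"
  assumes S: "convex S" and \<mu>: "\<mu> > 0"
    and grad: "\<And>x. x \<in> S \<Longrightarrow> GDERIV f x :> g x"
    and hess: "\<And>x. x \<in> S \<Longrightarrow> (g has_derivative (\<lambda>h. H x *v h)) (at x)"
    and bound: "\<And>x v. x \<in> S \<Longrightarrow> \<mu> * (norm v)\<^sup>2 \<le> v \<bullet> (H x *v v)"
  shows "strongly_convex_on S f"
  unfolding strongly_convex_on_def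
proof (intro conjI exI[of _ \<mu>] ballI S \<mu>)
  fix x y and t :: real
  assume xy: "x \<in> S" "y \<in> S" and t: "t \<in> {0..1}"
  let ?v = "y - x" and ?N = "(norm (y - x))\<^sup>2"
  let ?p = "\<lambda>s. x + s *\<^sub>R (y - x)"
  let ?\<psi> = "\<lambda>s. f (?p s) - \<mu> / 2 * ?N * s\<^sup>2"
  have "convex_on {0..1} ?\<psi>"
  proof (rule f''_ge0_imp_convex)
    fix s :: real assume "s \<in> {0..1}"
    then have s: "?p s \<in> S"
      using convexD[OF S xy, of "1 - s" s] by (simp add: algebra_simps)
    have p: "(?p has_derivative (\<lambda>h. h *\<^sub>R ?v)) (at s)"
      by (auto intro!: derivative_eq_intros)
    have "((\<lambda>s. f (?p s)) has_derivative (\<lambda>h. (h *\<^sub>R ?v) \<bullet> g (?p s))) (at s)"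
      by (rule has_derivative_compose[OF p grad[OF s, unfolded gderiv_def]])
    then have "((\<lambda>s. f (?p s)) has_real_derivative ?v \<bullet> g (?p s)) (at s)"
      by (simp add: has_field_derivative_def mult.commute[of _ "?v \<bullet> g (?p s)"])
    then show "(?\<psi> has_real_derivative ?v \<bullet> g (?p s) - \<mu> * ?N * s) (at s)"
      by (auto intro!: derivative_eq_intros)
    have "((\<lambda>s. g (?p s)) has_derivative (\<lambda>h. H (?p s) *v (h *\<^sub>R ?v))) (at s)"
      by (rule has_derivative_compose[OF p hess[OF s]])
    then have "((\<lambda>s. ?v \<bullet> g (?p s)) has_derivative (\<lambda>h. ?v \<bullet> (H (?p s) *v (h *\<^sub>R ?v)))) (at s)"
      by (rule has_derivative_inner_right)
    then have "((\<lambda>s. ?v \<bullet> g (?p s)) has_real_derivative ?v \<bullet> (H (?p s) *v ?v)) (at s)"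
      by (simp add: has_field_derivative_def matrix_vector_mult_scaleR
          mult.commute[of _ "?v \<bullet> (H (?p s) *v ?v)"])
    then show "((\<lambda>s. ?v \<bullet> g (?p s) - \<mu> * ?N * s) has_real_derivative
        ?v \<bullet> (H (?p s) *v ?v) - \<mu> * ?N) (at s)"
      by (auto intro!: derivative_eq_intros)
    show "0 \<le> ?v \<bullet> (H (?p s) *v ?v) - \<mu> * ?N" using bound[OF s] by simp
  qed simp
  then have "?\<psi> ((1 - t) *\<^sub>R 0 + t *\<^sub>R 1) \<le> (1 - t) * ?\<psi> 0 + t * ?\<psi> 1"
    using t by (intro convex_onD) auto
  moreover have "?p t = (1 - t) *\<^sub>R x + t *\<^sub>R y" by (simp add: algebra_simps)
  ultimately show "f ((1 - t) *\<^sub>R x + t *\<^sub>R y)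
      \<le> (1 - t) * f x + t * f y - \<mu> / 2 * t * (1 - t) * (norm (x - y))\<^sup>2"
    by (simp add: norm_minus_commute algebra_simps power2_eq_square diff_divide_distrib)
qed

section \<open>Lower bound on the curvature near the true location\<close>

text \<open>
  For nonzero \<open>d\<close>, rescaling it to the length of \<open>p\<close> changes it by at most \<open>norm (d - p)\<close>, so \<open>p\<close> and the rescaled
  \<open>d\<close>, both of length \<open>norm p\<close>, are at most twice \<open>norm (d - p)\<close> apart.
\<close>

lemma norm_sgn_diff_le:
  fixes d p :: "'a :: real_inner"
  assumes "p \<noteq> 0"
  shows "norm (sgn d - sgn p) \<le> 2 * norm (d - p) / norm p"
proof -
  have "norm p *\<^sub>R (sgn d - sgn p) = (norm p - norm d) *\<^sub>R sgn d + (d - p)"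
    by (cases "d = 0") (use assms in \<open>simp_all add: sgn_div_norm algebra_simps\<close>)
  then have "norm p * norm (sgn d - sgn p) = norm ((norm p - norm d) *\<^sub>R sgn d + (d - p))"
    by (metis abs_norm_cancel norm_scaleR)
  also have "\<dots> \<le> \<bar>norm p - norm d\<bar> * norm (sgn d) + norm (d - p)"
    by (metis norm_scaleR norm_triangle_ineq)
  also have "\<dots> \<le> norm (d - p) * 1 + norm (d - p)"
    using norm_triangle_ineq3[of p d]
    by (intro add_mono mult_mono) (auto simp: norm_minus_commute norm_sgn)
  finally show ?thesis using assms by (simp add: field_simps)
qed

text \<open>
  The right-hand side is half the second derivative, in direction \<open>v\<close>, of the summand belonging
  to one anchor; \<open>d\<close> and \<open>p\<close> are the positions of the current point and of the true location
  relative to that anchor. The isotropic coefficient \<open>1 - q\<close> can be negative, but only by the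
  relative error \<open>(norm (d - p) + \<bar>w\<bar>) / norm d\<close>. The radial coefficient \<open>q\<close> is bounded away from
  \<open>0\<close>, since the measured range is at least half the true one and the current range at most
  \<open>11 / 10\<close> of it, whence \<open>5 / 11\<close>. Replacing the current direction by the true one costs
  at most twice the distance of the two unit vectors, times \<open>(norm v)\<^sup>2\<close>.
\<close>

lemma range_curvature_lower_bound:
  fixes d p v :: "'a :: real_inner"
  assumes \<delta>: "\<delta> > 0" "\<delta> \<le> norm p" and e: "norm (d - p) \<le> \<delta> / 10"
    and w: "\<bar>w\<bar> \<le> norm p / 2"
  defines "q \<equiv> (norm p + w) / norm d"
  shows "5 / 11 * (sgn p \<bullet> v)\<^sup>2 -
        (10 / 9 * (norm (d - p) + \<bar>w\<bar>) / \<delta> + 20 / 11 * norm (d - p) / \<delta>) * (norm v)\<^sup>2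
      \<le> (1 - q) * (norm v)\<^sup>2 + q * (sgn d \<bullet> v)\<^sup>2"
proof -
  let ?e = "norm (d - p)"
  have D: "norm p - ?e \<le> norm d" "norm d \<le> norm p + ?e"
    using norm_triangle_ineq2[of p d] norm_triangle_ineq2[of d p]
    by (simp_all add: norm_minus_commute)
  \<comment> \<open>The current range keeps nine tenths of \<open>\<delta>\<close>; this is where the factor \<open>10 / 9\<close> comes from.\<close>
  then have pos: "9 / 10 * \<delta> \<le> norm d" "norm d > 0" using \<delta> e by linarith+
  have "norm p / 2 \<le> norm p + w" using w by (auto simp: abs_le_iff)
  then have "5 / 11 \<le> q"
    unfolding q_def using D \<delta> e w pos by (simp add: le_divide_eq)
  have "- (10 / 9 * (?e + \<bar>w\<bar>) / \<delta>) \<le> 1 - q"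
  proof -
    have "q - 1 = (norm p + w - norm d) / norm d" unfolding q_def using pos by (simp add: diff_divide_distrib)
    also have "\<dots> \<le> (?e + \<bar>w\<bar>) / norm d" using D pos by (intro divide_right_mono) auto
    also have "\<dots> \<le> (?e + \<bar>w\<bar>) / (9 / 10 * \<delta>)" using pos \<delta> by (intro divide_left_mono) auto
    also have "\<dots> = 10 / 9 * (?e + \<bar>w\<bar>) / \<delta>" by simp
    finally show ?thesis by linarith
  qed
  then have 1: "- (10 / 9 * (?e + \<bar>w\<bar>) / \<delta>) * (norm v)\<^sup>2 \<le> (1 - q) * (norm v)\<^sup>2"
    by (rule mult_right_mono) simp
  have "(sgn p \<bullet> v)\<^sup>2 - (sgn d \<bullet> v)\<^sup>2 = - ((sgn d - sgn p) \<bullet> v) * ((sgn d + sgn p) \<bullet> v)"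
    by (simp add: inner_diff_left inner_add_left power2_eq_square algebra_simps)
  also have "\<dots> \<le> \<bar>(sgn d - sgn p) \<bullet> v\<bar> * \<bar>(sgn d + sgn p) \<bullet> v\<bar>"
    by (metis abs_ge_self abs_minus_cancel abs_mult)
  also have "\<dots> \<le> (2 * ?e / \<delta> * norm v) * (2 * norm v)"
  proof (intro mult_mono)
    have "norm (sgn d - sgn p) \<le> 2 * ?e / norm p" using \<delta> by (intro norm_sgn_diff_le) auto
    also have "\<dots> \<le> 2 * ?e / \<delta>" using \<delta> by (intro frac_le) auto
    finally show "\<bar>(sgn d - sgn p) \<bullet> v\<bar> \<le> 2 * ?e / \<delta> * norm v"
      by (meson Cauchy_Schwarz_ineq2 mult_right_mono norm_ge_zero order_trans)
    have "norm (sgn d + sgn p) \<le> 2"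
      by (rule order_trans[OF norm_triangle_ineq]) (simp add: norm_sgn)
    then show "\<bar>(sgn d + sgn p) \<bullet> v\<bar> \<le> 2 * norm v"
      by (meson Cauchy_Schwarz_ineq2 mult_right_mono norm_ge_zero order_trans)
  qed (use \<delta> in auto)
  also have "\<dots> = 4 * (?e / \<delta> * (norm v)\<^sup>2)" by (simp add: power2_eq_square)
  finally have "(sgn p \<bullet> v)\<^sup>2 - (sgn d \<bullet> v)\<^sup>2 \<le> 4 * (?e / \<delta> * (norm v)\<^sup>2)" .
  moreover have "20 / 11 * ?e / \<delta> * (norm v)\<^sup>2 = 20 / 11 * (?e / \<delta> * (norm v)\<^sup>2)" by simp
  ultimately have "5 / 11 * (sgn p \<bullet> v)\<^sup>2 - 20 / 11 * ?e / \<delta> * (norm v)\<^sup>2 \<le> 5 / 11 * (sgn d \<bullet> v)\<^sup>2"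
    by argo
  also have "\<dots> \<le> q * (sgn d \<bullet> v)\<^sup>2" using \<open>5 / 11 \<le> q\<close> by (intro mult_right_mono) auto
  finally show ?thesis using 1 by (simp add: algebra_simps)
qed

text \<open>
  Test with a single unit vector: each summand is then at most \<open>1\<close>. For the
  least-squares loss this puts every point of the ball within \<open>\<delta> / 10\<close> of the true location, hence
  away from the anchors.
\<close>

lemma rayleigh_constant_le_card:
  fixes p :: "'i \<Rightarrow> real ^ 'n"
  assumes rayleigh: "\<And>v. L * (norm v)\<^sup>2 \<le> (\<Sum>i\<in>I. (sgn (p i) \<bullet> v)\<^sup>2)"
  shows "L \<le> real (card I)"
proof -
  fix k :: 'n
  have "L \<le> (\<Sum>i\<in>I. (sgn (p i) \<bullet> axis k 1)\<^sup>2)"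
    using rayleigh[of "axis k 1"] by simp
  also have "\<dots> \<le> (\<Sum>i\<in>I. 1)"
  proof (intro sum_mono)
    fix i
    have "\<bar>sgn (p i) \<bullet> axis k 1\<bar> \<le> norm (sgn (p i)) * norm (axis k 1 :: real ^ 'n)"
      by (rule Cauchy_Schwarz_ineq2)
    also have "\<dots> \<le> 1" by (simp add: norm_sgn)
    finally show "(sgn (p i) \<bullet> axis k 1)\<^sup>2 \<le> 1" by (simp add: abs_square_le_1)
  qed
  finally show ?thesis by simp
qed

text \<open>
  Adding up the bounds of all anchors leaves \<open>5 / 11 * L\<close> minus
  \<open>(10 / 9 + 20 / 11) * (m * e) / \<delta> + 10 / 9 * W / \<delta>\<close>, where \<open>e\<close> is the distance to the true location
  and \<open>W\<close> the total noise. Since \<open>10 / 9 \<le> 4 / 5 * (10 / 9 + 20 / 11)\<close>, the budget bounds the loss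
  by \<open>(10 / 9 + 20 / 11) / 10 * L \<le> 3 / 10 * L\<close>, and at least \<open>3 / 20 * L\<close> remains. The second
  derivative is twice this sum.
\<close>

lemma least_squares_hessian_lower_bound:
  fixes a :: "nat \<Rightarrow> real ^ 'n"
  assumes \<delta>: "\<delta> > 0" "\<And>i. i \<in> {1..m} \<Longrightarrow> \<delta> \<le> norm (xstar - a i)"
    and w: "\<And>i. i \<in> {1..m} \<Longrightarrow> \<bar>w i\<bar> \<le> norm (xstar - a i) / 2"
    and close: "norm (x - xstar) \<le> \<delta> / 10"
    and rayleigh: "L * (norm v)\<^sup>2 \<le> (\<Sum>i = 1..m. (sgn (xstar - a i) \<bullet> v)\<^sup>2)"
    and budget: "real m * norm (x - xstar) + 4 / 5 * (\<Sum>i = 1..m. \<bar>w i\<bar>) \<le> \<delta> * L / 10"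
  shows "3 / 10 * L * (norm v)\<^sup>2
    \<le> v \<bullet> (least_squares_hessian m a (\<lambda>i. norm (xstar - a i) + w i) x *v v)"
proof -
  let ?e = "norm (x - xstar)" and ?W = "\<Sum>i = 1..m. \<bar>w i\<bar>"
  let ?loss = "10 / 9 * (real m * ?e + ?W) / \<delta> + 20 / 11 * (real m * ?e) / \<delta>"
  have loss: "?loss \<le> 5 / 11 * L - 3 / 20 * L"
  proof -
    \<comment> \<open>\<open>67 / 220\<close> is the difference of \<open>5 / 11\<close> and \<open>3 / 20\<close>.\<close>
    have "10 / 9 * (A + B) + 20 / 11 * A \<le> 67 / 220 * C"
      if "A + 4 / 5 * B \<le> C / 10" "0 \<le> A" "0 \<le> B" for A B C :: real
      using that by argo
    from this[OF budget] have "10 / 9 * (real m * ?e + ?W) + 20 / 11 * (real m * ?e) \<le> 67 / 220 * (\<delta> * L)"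
      by (simp add: sum_nonneg)
    then have "(10 / 9 * (real m * ?e + ?W) + 20 / 11 * (real m * ?e)) / \<delta> \<le> 67 / 220 * L"
      using \<delta>(1) by (simp add: divide_le_eq mult_ac)
    then show ?thesis by (simp add: add_divide_distrib algebra_simps)
  qed
  have "3 / 20 * L * (norm v)\<^sup>2 \<le> 5 / 11 * (L * (norm v)\<^sup>2) - ?loss * (norm v)\<^sup>2"
    using mult_right_mono[OF loss zero_le_power2[of "norm v"]]
    by (simp only: left_diff_distrib mult.assoc)
  also have "\<dots> \<le> 5 / 11 * (\<Sum>i = 1..m. (sgn (xstar - a i) \<bullet> v)\<^sup>2) - ?loss * (norm v)\<^sup>2"
    using rayleigh by simp
  also have "\<dots> = (\<Sum>i = 1..m. 5 / 11 * (sgn (xstar - a i) \<bullet> v)\<^sup>2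
      - (10 / 9 * (?e + \<bar>w i\<bar>) / \<delta> + 20 / 11 * ?e / \<delta>) * (norm v)\<^sup>2)"
    by (simp add: sum_subtractf sum.distrib algebra_simps add_divide_distrib
        flip: sum_distrib_left sum_distrib_right sum_divide_distrib)
  also have "\<dots> \<le> (\<Sum>i = 1..m.
      (1 - (norm (xstar - a i) + w i) / norm (x - a i)) * (norm v)\<^sup>2
      + (norm (xstar - a i) + w i) / norm (x - a i) * (sgn (x - a i) \<bullet> v)\<^sup>2)"
  proof (rule sum_mono)
    fix i assume i: "i \<in> {1..m}"
    have "(x - a i) - (xstar - a i) = x - xstar" by simp
    then show "5 / 11 * (sgn (xstar - a i) \<bullet> v)\<^sup>2
      - (10 / 9 * (?e + \<bar>w i\<bar>) / \<delta> + 20 / 11 * ?e / \<delta>) * (norm v)\<^sup>2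
      \<le> (1 - (norm (xstar - a i) + w i) / norm (x - a i)) * (norm v)\<^sup>2
      + (norm (xstar - a i) + w i) / norm (x - a i) * (sgn (x - a i) \<bullet> v)\<^sup>2"
      using range_curvature_lower_bound[OF \<delta>(1) \<delta>(2)[OF i] _ w[OF i], of "x - a i" v] close
      by simp
  qed
  finally show ?thesis
    unfolding quadratic_form_least_squares_hessian by linarith
qed

section \<open>Strong convexity around the least-squares estimate\<close>

theorem theorem1:
  fixes m :: nat
    and a :: "nat \<Rightarrow> real ^ 'n"
    and xstar xhat :: "real ^ 'n"
    and c0 \<sigma> K1 K2 \<delta> \<Lambda> \<kappa> :: real
    and M :: "'p measure"
    and W :: "nat \<Rightarrow> 'p \<Rightarrow> real"
    and \<omega> :: 'p
    and w r :: "nat \<Rightarrow> real"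
    and f :: "real ^ 'n \<Rightarrow> real"
  defines "w \<equiv> (\<lambda>i. W i \<omega>)"
    and "r \<equiv> (\<lambda>i. norm (xstar - a i) + w i)"
    and "f \<equiv> least_squares_loss m a r"
    and "\<Lambda> \<equiv> lambda_min (\<Sum>i = 1..m.
           outer_product ((xstar - a i) /\<^sub>R norm (xstar - a i))
                         ((xstar - a i) /\<^sub>R norm (xstar - a i)))"
    and "\<kappa> \<equiv> \<delta> / (10 * real m) * \<Lambda> - (K1 * sqrt (real m) * \<sigma> + K2 * real m * \<sigma>\<^sup>2)
               - 4 * c0 * \<sigma> / 5"
  assumes "m \<ge> 1"
    and "span ((\<lambda>i. a i - a 1) ` {2..m}) = UNIV"
    and "c0 > 0" and "\<sigma> \<ge> 0"
    and "noise_model M W m \<sigma>" and "\<omega> \<in> space M"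
    and "\<forall>i\<in>{1..m}. \<bar>w i\<bar> \<le> 1 / 2 * norm (xstar - a i)"
    and "L2_set w {1..m} \<le> c0 * sqrt (real m) * \<sigma>"
    and "is_arg_min f (\<lambda>_. True) xhat"
    and "estimation_error_constants m a xstar c0 K1 K2"
    and "\<delta> > 0"
    and "\<forall>i\<in>{1..m}. norm (xstar - a i) > K1 * sqrt (real m) * \<sigma> + K2 * real m * \<sigma>\<^sup>2 + \<delta>"
    and "\<kappa> > 0"
  shows "(\<forall>\<epsilon>. norm \<epsilon> \<le> \<kappa> \<longrightarrow> (\<exists>H. has_hessian f H (xhat + \<epsilon>) \<and> positive_definite H))
       \<and> strongly_convex_on (cball xhat \<kappa>) f"
proof -
  define E where "E = K1 * sqrt (real m) * \<sigma> + K2 * real m * \<sigma>\<^sup>2"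
  define G where "G = (\<Sum>i = 1..m. outer_product ((xstar - a i) /\<^sub>R norm (xstar - a i))
                         ((xstar - a i) /\<^sub>R norm (xstar - a i)))"
  have m: "real m > 0" using \<open>m \<ge> 1\<close> by simp
  \<comment> \<open>The realized noise is an admissible perturbation at level \<open>\<sigma>\<close>.\<close>
  have E0: "E \<ge> 0" and error: "norm (xhat - xstar) \<le> E"
    using assms(9-15) unfolding estimation_error_constants_def E_def f_def r_def
    by (auto simp: mult_ac)
  have rayleigh: "\<Lambda> * (norm v)\<^sup>2 \<le> (\<Sum>i = 1..m. (sgn (xstar - a i) \<bullet> v)\<^sup>2)" for v
  proof -
    have "\<Lambda> * (norm v)\<^sup>2 \<le> v \<bullet> (G *v v)"
      unfolding \<Lambda>_def G_def
      by (intro lambda_min_rayleigh symmetric_sum symmetric_outer_product)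
    also have "\<dots> = (\<Sum>i = 1..m. (sgn (xstar - a i) \<bullet> v)\<^sup>2)"
      unfolding G_def sum_matrix_mult_vec outer_product_mult_vec
      by (simp add: inner_sum_right sgn_div_norm power2_eq_square inner_commute mult_ac)
    finally show ?thesis .
  qed
  have "\<Lambda> \<le> real m"
    using rayleigh_constant_le_card[of \<Lambda> "\<lambda>i. xstar - a i" "{1..m}"] rayleigh by simp
  have \<kappa>: "E + \<kappa> = \<delta> / (10 * real m) * \<Lambda> - 4 * c0 * \<sigma> / 5"
    unfolding \<kappa>_def E_def by simp
  have c\<sigma>: "c0 * \<sigma> \<ge> 0" using assms by simp
  \<comment> \<open>The spectral term of \<open>\<kappa>\<close> has to outweigh the other two, which are nonpositive.\<close>
  have "\<delta> / (10 * real m) * \<Lambda> > 0"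
    using \<kappa> E0 c\<sigma> \<open>\<kappa> > 0\<close> by linarith
  then have "\<Lambda> > 0" using m \<open>\<delta> > 0\<close> by (simp add: zero_less_mult_iff zero_less_divide_iff)
  have noise: "(\<Sum>i = 1..m. \<bar>w i\<bar>) \<le> real m * (c0 * \<sigma>)"
  proof -
    have "(\<Sum>i = 1..m. \<bar>w i\<bar>) = (\<Sum>i = 1..m. \<bar>w i\<bar> * \<bar>1\<bar>)" by simp
    also have "\<dots> \<le> L2_set w {1..m} * L2_set (\<lambda>_. 1) {1..m}" by (rule L2_set_mult_ineq)
    also have "\<dots> \<le> c0 * sqrt (real m) * \<sigma> * sqrt (real m)"
      using assms by (simp add: L2_set_constant mult_right_mono)
    also have "\<dots> = real m * (c0 * \<sigma>)" by simp
    finally show ?thesis .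
  qed
  have close: "norm (x - xstar) \<le> \<delta> / (10 * real m) * \<Lambda> - 4 * c0 * \<sigma> / 5"
    if "x \<in> cball xhat \<kappa>" for x
  proof -
    have "norm (x - xstar) \<le> norm (x - xhat) + norm (xhat - xstar)"
      using norm_triangle_ineq[of "x - xhat" "xhat - xstar"] by simp
    then show ?thesis using that error \<kappa> by (simp add: dist_norm norm_minus_commute)
  qed
  have tenth: "norm (x - xstar) \<le> \<delta> / 10" if "x \<in> cball xhat \<kappa>" for x
  proof -
    have "\<delta> / (10 * real m) * \<Lambda> \<le> \<delta> / (10 * real m) * real m"
      using \<open>\<Lambda> \<le> real m\<close> \<open>\<delta> > 0\<close> by (intro mult_left_mono) auto
    also have "\<dots> = \<delta> / 10" using m by simp
    finally show ?thesis using close[OF that] c\<sigma> by linarith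
  qed
  have far: "\<delta> \<le> norm (xstar - a i)" if "i \<in> {1..m}" for i
    using assms(17) that E0 unfolding E_def by fastforce
  have off: "x \<noteq> a i" if x: "x \<in> cball xhat \<kappa>" and i: "i \<in> {1..m}" for x i
    using tenth[OF x] far[OF i] \<open>\<delta> > 0\<close> by (auto simp: norm_minus_commute)
  have bound: "3 / 10 * \<Lambda> * (norm v)\<^sup>2 \<le> v \<bullet> (least_squares_hessian m a r x *v v)"
    if x: "x \<in> cball xhat \<kappa>" for x v
    unfolding r_def
  proof (rule least_squares_hessian_lower_bound[OF \<open>\<delta> > 0\<close> far _ tenth[OF x] rayleigh])
    show "\<bar>w i\<bar> \<le> norm (xstar - a i) / 2" if "i \<in> {1..m}" for i using assms that by simp
    have "real m * norm (x - xstar) \<le> real m * (\<delta> / (10 * real m) * \<Lambda> - 4 * c0 * \<sigma> / 5)"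
      using close[OF x] by (intro mult_left_mono) auto
    also have "\<dots> = \<delta> * \<Lambda> / 10 - 4 / 5 * (real m * (c0 * \<sigma>))"
      using m by (simp add: field_simps)
    finally show "real m * norm (x - xstar) + 4 / 5 * (\<Sum>i = 1..m. \<bar>w i\<bar>) \<le> \<delta> * \<Lambda> / 10"
      using noise by linarith
  qed
  show ?thesis
  proof (intro conjI allI impI)
    fix \<epsilon> :: "real ^ 'n" assume "norm \<epsilon> \<le> \<kappa>"
    then have x: "xhat + \<epsilon> \<in> cball xhat \<kappa>" by (simp add: dist_norm)
    have "v \<bullet> (least_squares_hessian m a r (xhat + \<epsilon>) *v v) > 0" if "v \<noteq> 0" for v
      by (rule less_le_trans[OF _ bound[OF x]]) (use that \<open>\<Lambda> > 0\<close> in simp)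
    then have "positive_definite (least_squares_hessian m a r (xhat + \<epsilon>))"
      unfolding positive_definite_def using symmetric_least_squares_hessian by blast
    then show "\<exists>H. has_hessian f H (xhat + \<epsilon>) \<and> positive_definite H"
      unfolding f_def using has_hessian_least_squares_loss[of m "xhat + \<epsilon>" a r] off[OF x] by blast
  next
    show "strongly_convex_on (cball xhat \<kappa>) f"
      unfolding f_def
    proof (rule strongly_convex_on_hessian[where g = "least_squares_gradient m a r"
          and H = "least_squares_hessian m a r"])
      show "3 / 10 * \<Lambda> > 0" using \<open>\<Lambda> > 0\<close> by simp
      fix x assume x: "x \<in> cball xhat \<kappa>"
      show "GDERIV (least_squares_loss m a r) x :> least_squares_gradient m a r x"
        by (rule GDERIV_least_squares_loss) (rule off[OF x])
      show "(least_squares_gradient m a r has_derivative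
          (\<lambda>h. least_squares_hessian m a r x *v h)) (at x)"
        by (rule has_derivative_least_squares_gradient) (rule off[OF x])
    qed (rule convex_cball bound, assumption?)+
  qed
qed

end
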